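(* Let $p>3$ be a prime and let $C_k=\binom{2k}k/(k+1)$. Then, modulo $p$, $$\sum_{k=0}^{p-1}\frac{k\binom{4k}{2k}\binom{2k}k}{72^k}\equiv\frac32\sum_{k=0}^{p-1}\frac{\binom{4k}{2k}C_k}{72^k}\equiv\begin{cases}\left(\frac 6p\right)x\pmod p&\text{if}\ p=x^2+y^2\ \text{with}\ x,y\in\mathbb Z,\ 4\mid x-1,\ 2\mid y,\\[2pt] \frac 34\left(\frac 6p\right)\binom{(p+1)/2}{(p+1)/4}\pmod p&\text{if}\ p\equiv3\pmod4.\end{cases}$$
   Context: $\left(\frac{\cdot}{p}\right)$ is the Legendre symbol. For rational numbers $a,b$ whose denominators are not divisible by $p$, $a\equiv b\pmod{p}$ means $(a-b)/p$ has denominator not divisible by $p$. *)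

theory Defs
  imports Complex_Main "HOL-Number_Theory.Number_Theory"
begin

definition p_integral :: "nat \<Rightarrow> rat \<Rightarrow> bool" where
  "p_integral p a \<longleftrightarrow> \<not> int p dvd snd (quotient_of a)"

text \<open>Congruence is only meaningful between rationals whose denominators are not divisible
  by \<open>p\<close>; this is made part of the relation.\<close>

definition rat_cong :: "rat \<Rightarrow> rat \<Rightarrow> nat \<Rightarrow> bool"
    (\<open>(\<open>indent=1\<close>[_ \<equiv> _] '(rmod _'))\<close>) where
  "[a \<equiv> b] (rmod p) \<longleftrightarrow>
     p_integral p a \<and> p_integral p b \<and> p_integral p ((a - b) / of_nat p)"

definition catalan :: "nat \<Rightarrow> rat" where
  "catalan k = of_nat ((2 * k) choose k) / of_nat (k + 1)"

end

theory Submission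
  imports Defs
begin

text \<open>
  Write \<open>p = 2 m + 1\<close> and let \<open>a k\<close> be the \<open>k\<close>-th coefficient, without the weights \<open>k\<close> and
  \<open>1 / (k + 1)\<close>. The two sums agree because
  \<open>(k + 1) a (k + 1) - k a k = - 1/9 (k - 3/2 / (k + 1)) a k\<close> telescopes exactly.
  Modulo \<open>p\<close> one has \<open>binom (4 k) (2 k) \<equiv> 16 ^ k binom m (2 k)\<close>, which turns the first sum into a
  coefficient of \<open>(z\<^sup>2 + z + 2/9) ^ (m - 1)\<close>, a product of powers of \<open>z + 1/3\<close> and \<open>z + 2/3\<close>. After
  scaling, it is the coefficient of \<open>t ^ (p - 1)\<close> in \<open>t (t (t + 1) (t + 2)) ^ (m - 1)\<close>, that is, a
  power sum over a complete residue system. This sum is invariant under \<open>t \<mapsto> t - 1\<close>, and the shifted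
  polynomial \<open>(t - 1) (t\<^sup>3 - t) ^ (m - 1)\<close> has the required coefficient as a single binomial
  coefficient. For \<open>p \<equiv> 1\<close> modulo 4 one then needs Gauss's congruence
  \<open>binom m (m / 2) \<equiv> 2 x\<close>, which follows from Jacobsthal's evaluation of the sum of the Legendre
  symbols of \<open>t\<^sup>3 - t\<close>.
\<close>

section \<open>Residue arithmetic modulo an odd prime \<open>p = 2 * m + 1\<close>\<close>

locale odd_prime =
  fixes p m :: nat
  assumes prime_p: "prime p" and p_eq: "p = 2 * m + 1"
begin

abbreviation residue_set :: "int set" where "residue_set \<equiv> {0..<int p}"

abbreviation chi :: "int \<Rightarrow> int" where "chi a \<equiv> Legendre a (int p)"

lemma p_gt_2: "p > 2"
  using prime_gt_1_nat[OF prime_p] p_eq by simp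

lemma m_pos: "m > 0"
  using p_gt_2 p_eq by simp

lemma prime_int_p: "prime (int p)"
  using prime_p by simp

lemma coprime_pI: "\<not> int p dvd a \<Longrightarrow> coprime a (int p)"
  using prime_imp_coprime[OF prime_int_p] coprime_commute by blast

lemma not_dvd_small: "a \<noteq> 0 \<Longrightarrow> \<bar>a\<bar> < int p \<Longrightarrow> \<not> int p dvd a"
  using zdvd_imp_le[of "int p" "\<bar>a\<bar>"] by auto

lemma cong_eq_0I: "[a * b = 0] (mod int p) \<Longrightarrow> \<not> int p dvd a \<Longrightarrow> [b = 0] (mod int p)"
  using prime_int_p by (simp add: cong_0_iff prime_dvd_mult_iff)

subsection \<open>Sums over a complete residue system\<close>

text \<open>As \<open>u\<close> is a unit modulo \<open>p\<close>, the map
  \<open>t \<mapsto> (u * t + v) mod p\<close> permutes \<open>residue_set\<close>, and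
  \<open>f\<close> sees only residue classes.\<close>

lemma sum_residues_affine:
  fixes f :: "int \<Rightarrow> 'a::comm_monoid_add"
  assumes f: "\<And>x y. [x = y] (mod int p) \<Longrightarrow> f x = f y" and u: "\<not> int p dvd u"
  shows "(\<Sum>t\<in>residue_set. f (u * t + v)) = (\<Sum>t\<in>residue_set. f t)"
proof -
  let ?h = "\<lambda>t. (u * t + v) mod int p"
  have inj: "inj_on ?h residue_set"
  proof (rule inj_onI)
    fix s t assume st: "s \<in> residue_set" "t \<in> residue_set" "?h s = ?h t"
    then have "[u * s + v = u * t + v] (mod int p)"
      by (simp add: cong_def)
    then have "[s = t] (mod int p)"
      using u coprime_pI by (simp add: cong_add_rcancel cong_mult_lcancel)
    with st show "s = t"
      by (simp add: cong_def)
  qed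
  moreover have "?h ` residue_set \<subseteq> residue_set"
    using p_gt_2 by auto
  ultimately have img: "?h ` residue_set = residue_set"
    by (intro endo_inj_surj) auto
  have "(\<Sum>t\<in>residue_set. f (u * t + v)) = (\<Sum>t\<in>residue_set. f (?h t))"
    by (intro sum.cong refl f) (simp add: cong_def)
  also have "\<dots> = (\<Sum>t\<in>?h ` residue_set. f t)"
    using inj by (simp add: sum.reindex)
  finally show ?thesis
    by (simp only: img)
qed

lemma cong_sum_residues_affine:
  fixes f :: "int \<Rightarrow> int"
  assumes f: "\<And>x y. [x = y] (mod int p) \<Longrightarrow> [f x = f y] (mod int p)" and u: "\<not> int p dvd u"
  shows "[(\<Sum>t\<in>residue_set. f (u * t + v)) = (\<Sum>t\<in>residue_set. f t)] (mod int p)"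
proof -
  \<comment> \<open>Reduced modulo \<open>p\<close>, the values of \<open>f\<close> depend only on
    the residue class, so the exact invariance applies.\<close>
  have "(\<Sum>t\<in>residue_set. f (u * t + v) mod int p) = (\<Sum>t\<in>residue_set. f t mod int p)"
    by (rule sum_residues_affine[OF _ u]) (rule f[unfolded cong_def[of "f _"]])
  from arg_cong[OF this, of "\<lambda>s. s mod int p"] show ?thesis
    unfolding cong_def mod_sum_eq .
qed

lemma fermat_int: "\<not> int p dvd a \<Longrightarrow> [a ^ (p - 1) = 1] (mod int p)"
proof -
  assume a: "\<not> int p dvd a"
  let ?b = "nat (a mod int p)"
  have b: "int ?b = a mod int p"
    using p_gt_2 by simp
  have "\<not> p dvd ?b"
    by (metis a b dvd_mod_iff dvd_refl int_dvd_int_iff)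
  then have "[?b ^ (p - 1) = 1] (mod p)"
    by (rule fermat_theorem[OF prime_p])
  then have "[int ?b ^ (p - 1) = 1] (mod int p)"
    by (metis cong_int_iff of_nat_1 of_nat_power)
  then show ?thesis
    unfolding b by (simp add: cong_def power_mod)
qed

text \<open>A primitive root has order exactly \<open>p - 1\<close>.\<close>

lemma exists_power_not_cong_1:
  assumes "\<not> (p - 1) dvd j"
  obtains g :: int where "\<not> int p dvd g" "\<not> [g ^ j = 1] (mod int p)"
proof -
  obtain g where g: "residue_primroot p g"
    using prime_primitive_root_exists[of p] prime_p prime_gt_1_nat by auto
  then have c: "coprime p g" and o: "ord p g = p - 1"
    using prime_p by (auto simp: residue_primroot_def totient_prime)
  have "\<not> int p dvd int g"
    using c p_gt_2 by (auto simp: coprime_absorb_left)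
  moreover have "\<not> [int g ^ j = 1] (mod int p)"
    using assms o ord_divides[of g j p] by (metis cong_int_iff of_nat_1 of_nat_power)
  ultimately show ?thesis
    using that by blast
qed

text \<open>Scaling by \<open>g\<close> fixes the sum modulo \<open>p\<close> and multiplies it by
  \<open>g ^ j\<close>, so it vanishes unless \<open>p - 1\<close> divides \<open>j\<close>; the
  bound leaves \<open>0\<close> and \<open>p - 1\<close> as the only such exponents. For
  \<open>j = 0\<close> the convention \<open>0 ^ 0 = 1\<close> gives \<open>p\<close> summands equal
  to 1.\<close>

lemma power_sum_residues:
  assumes "j < 2 * (p - 1)"
  shows "[(\<Sum>t\<in>residue_set. t ^ j) = (if j = p - 1 then -1 else 0)] (mod int p)"
proof (cases "j = 0 \<or> j = p - 1")
  case True
  then show ?thesis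
  proof
    assume "j = 0"
    then show ?thesis
      using p_gt_2 by (simp add: cong_0_iff)
  next
    assume j: "j = p - 1"
    have "residue_set = insert 0 {1..<int p}"
      using p_gt_2 by auto
    then have "(\<Sum>t\<in>residue_set. t ^ j) = (\<Sum>t\<in>{1..<int p}. t ^ (p - 1))"
      using j p_gt_2 by simp
    also have "[\<dots> = (\<Sum>t\<in>{1..<int p}. 1)] (mod int p)"
      by (intro cong_sum fermat_int not_dvd_small) auto
    also have "(\<Sum>t\<in>{1..<int p}. 1) = int p - 1"
      using p_gt_2 by simp
    also have "[int p - 1 = -1] (mod int p)"
      by (simp add: cong_iff_dvd_diff)
    finally show ?thesis
      using j by simp
  qed
next
  case False
  have "\<not> (p - 1) dvd j"
  proof
    assume "(p - 1) dvd j"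
    then obtain c where c: "j = (p - 1) * c" by auto
    with assms have "c < 2" by (simp add: mult.commute)
    then have "c = 0 \<or> c = 1" by linarith
    with c False show False by auto
  qed
  then obtain g where g: "\<not> int p dvd g" "\<not> [g ^ j = 1] (mod int p)"
    using exists_power_not_cong_1 by blast
  have "[(\<Sum>t\<in>residue_set. (g * t + 0) ^ j) = (\<Sum>t\<in>residue_set. t ^ j)] (mod int p)"
    by (rule cong_sum_residues_affine) (use g in \<open>auto intro: cong_pow\<close>)
  then have "[(g ^ j - 1) * (\<Sum>t\<in>residue_set. t ^ j) = 0] (mod int p)"
    by (simp add: power_mult_distrib sum_distrib_left[symmetric] cong_iff_dvd_diff left_diff_distrib)
  moreover have "\<not> int p dvd g ^ j - 1"
    using g(2) by (simp add: cong_iff_dvd_diff)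
  ultimately have "[(\<Sum>t\<in>residue_set. t ^ j) = 0] (mod int p)"
    by (rule cong_eq_0I)
  then show ?thesis
    using False by simp
qed

subsection \<open>The Legendre symbol as a character\<close>

lemma euler: "[chi a = a ^ m] (mod int p)"
  using euler_criterion[OF prime_p p_gt_2, of a] by (simp add: p_eq)

lemma chi_cases: "chi a = 0 \<or> chi a = 1 \<or> chi a = -1"
  by (simp add: Legendre_def)

lemma chi_abs_le: "\<bar>chi a\<bar> \<le> 1"
  using chi_cases[of a] by auto

text \<open>Two elements of \<open>{-1, 0, 1}\<close> differ by at most 2, which is less than
  \<open>p\<close>; identities for \<open>chi\<close> thus reduce to congruences from Euler's
  criterion.\<close>

lemma chi_eqI:
  assumes "[chi a = c] (mod int p)" "c = 0 \<or> c = 1 \<or> c = -1"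
  shows "chi a = c"
proof (rule ccontr)
  assume "chi a \<noteq> c"
  moreover have "\<bar>chi a - c\<bar> < int p"
    using chi_abs_le[of a] assms(2) p_gt_2 by auto
  ultimately show False
    using assms(1) not_dvd_small[of "chi a - c"] by (simp add: cong_iff_dvd_diff)
qed

lemma chi_cong: "[a = b] (mod int p) \<Longrightarrow> chi a = chi b"
  by (rule chi_eqI[OF cong_trans[OF euler cong_trans[OF cong_pow cong_sym[OF euler]]] chi_cases])

lemma chi_mult: "chi (a * b) = chi a * chi b"
proof (rule chi_eqI)
  have "[a ^ m * b ^ m = chi a * chi b] (mod int p)"
    by (intro cong_mult cong_sym[OF euler])
  then show "[chi (a * b) = chi a * chi b] (mod int p)"
    using cong_trans[OF euler[of "a * b"]] by (simp add: power_mult_distrib)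
  show "chi a * chi b = 0 \<or> chi a * chi b = 1 \<or> chi a * chi b = -1"
    using chi_cases[of a] chi_cases[of b] by auto
qed

lemma chi_eq_0_iff: "chi a = 0 \<longleftrightarrow> int p dvd a"
  by (simp add: Legendre_def cong_0_iff)

lemma chi_square: "\<not> int p dvd a \<Longrightarrow> chi a * chi a = 1"
  using chi_cases[of a] chi_eq_0_iff[of a] by auto

lemma chi_1 [simp]: "chi 1 = 1"
  using p_gt_2 by (intro chi_eqI) (use euler[of 1] in auto)

lemma chi_0 [simp]: "chi 0 = 0"
  by (simp add: chi_eq_0_iff)

lemma chi_minus_1: "chi (-1) = (-1) ^ m"
  by (rule chi_eqI) (use euler[of "-1"] in \<open>auto simp: minus_one_power_iff\<close>)

lemma sum_chi_cong: "[(\<Sum>t\<in>A. chi (f t)) = (\<Sum>t\<in>A. f t ^ m)] (mod int p)"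
  by (intro cong_sum euler)

lemma chi_2: "chi 2 = (-1) ^ (m - m div 2)"
proof -
  interpret GAUSS p 2
    using prime_p p_gt_2 not_dvd_small[of 2] by unfold_locales (auto simp: cong_0_iff)
  have m: "(int p - 1) div 2 = int m"
    using p_eq by simp
  \<comment> \<open>Doubling \<open>1, ..., m\<close> never exceeds \<open>p\<close>, so Gauss's set
    \<open>C\<close> is just the set of doubles, and its members above \<open>m\<close> come from
    \<open>x > m div 2\<close>.\<close>
  have "C = (\<lambda>x. x * 2) ` {0<..int m}"
    unfolding C_def B_def A_def m image_image using p_eq by (intro image_cong refl) auto
  then have "E = (\<lambda>x. x * 2) ` {int m div 2<..int m}"
    unfolding E_def m by (auto simp: image_iff)
  then have "card E = card {int m div 2<..int m}"
    by (simp add: card_image inj_on_def)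
  also have "\<dots> = m - m div 2"
    by (simp add: nat_diff_distrib nat_div_distrib)
  finally show ?thesis
    using gauss_lemma by simp
qed

end

section \<open>Uniqueness of the representation of a prime as a sum of two squares\<close>

text \<open>Brahmagupta's identity bounds \<open>a * d - b * c\<close> by \<open>p\<close>, while
  \<open>p\<close> divides this or \<open>a * d + b * c\<close>; the second case is the first with
  \<open>d\<close> negated.\<close>

lemma sum_two_squares_odd_part_unique:
  fixes a b c d :: int
  assumes p: "prime p" "odd p" and ab: "p = a\<^sup>2 + b\<^sup>2" and cd: "p = c\<^sup>2 + d\<^sup>2"
    and "even b" "even d"
  shows "a\<^sup>2 = c\<^sup>2"
proof -
  have *: "a\<^sup>2 = c\<^sup>2"
    if dvd: "p dvd a * d - b * c" and cd: "p = c\<^sup>2 + d\<^sup>2" and "even d" for d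
  proof -
    let ?e = "a * d - b * c"
    \<comment> \<open>Both products are even, so the divisor doubles; this rules out the extreme
      value \<open>p\<close> that the bound alone would allow.\<close>
    have "2 * p dvd ?e"
      using dvd \<open>even b\<close> \<open>even d\<close> \<open>odd p\<close> by (intro divides_mult) auto
    moreover have "\<bar>?e\<bar> < 2 * p"
    proof -
      have "p\<^sup>2 = (a\<^sup>2 + b\<^sup>2) * (c\<^sup>2 + d\<^sup>2)"
        using ab cd by (simp add: power2_eq_square)
      also have "\<dots> = (a * c + b * d)\<^sup>2 + ?e\<^sup>2"
        by (simp add: power2_eq_square algebra_simps)
      finally have "?e\<^sup>2 \<le> p\<^sup>2"
        by simp
      then have "\<bar>?e\<bar> \<le> \<bar>p\<bar>"
        using abs_le_square_iff by blast
      then show ?thesis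
        using prime_gt_0_int[OF p(1)] by linarith
    qed
    ultimately have "?e = 0"
      using zdvd_imp_le[of "2 * p" "\<bar>?e\<bar>"] by auto
    moreover have "?e * (a * d + b * c) = a\<^sup>2 * (c\<^sup>2 + d\<^sup>2) - (a\<^sup>2 + b\<^sup>2) * c\<^sup>2"
      by (simp add: power2_eq_square algebra_simps)
    then have "?e * (a * d + b * c) = p * (a\<^sup>2 - c\<^sup>2)"
      unfolding ab[symmetric] cd[symmetric] by (simp add: algebra_simps)
    ultimately show ?thesis
      using prime_gt_0_int[OF p(1)] by simp
  qed
  have "(a * d - b * c) * (a * d + b * c) = a\<^sup>2 * (c\<^sup>2 + d\<^sup>2) - (a\<^sup>2 + b\<^sup>2) * c\<^sup>2"
    by (simp add: power2_eq_square algebra_simps)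
  also have "\<dots> = p * (a\<^sup>2 - c\<^sup>2)"
    unfolding ab[symmetric] cd[symmetric] by (simp add: algebra_simps)
  finally have "p dvd (a * d - b * c) * (a * d + b * c)"
    by simp
  then consider "p dvd a * d - b * c" | "p dvd a * d + b * c"
    using p(1) prime_dvd_mult_iff by blast
  then show ?thesis
  proof cases
    case 1
    then show ?thesis
      using *[of d] cd \<open>even d\<close> by blast
  next
    case 2
    then have "p dvd a * (- d) - b * c"
      using dvd_minus_iff[of p "a * d + b * c"] by simp
    then show ?thesis
      using *[of "- d"] cd \<open>even d\<close> by simp
  qed
qed

context odd_prime
begin

subsection \<open>Character sums of linear and quadratic polynomials\<close>

text \<open>As \<open>2 * m = p - 1\<close> and \<open>4 * m = 2 * (p - 1)\<close>, the power sums
  annihilate every monomial except those of degree \<open>p - 1\<close>: summing over residues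
  extracts minus a coefficient.\<close>

lemma sum_polynomial_cong:
  assumes "finite I" and "\<And>i. i \<in> I \<Longrightarrow> e i < 4 * m"
  shows "[(\<Sum>t\<in>residue_set. \<Sum>i\<in>I. c i * t ^ e i) = - (\<Sum>i\<in>I. if e i = 2 * m then c i else 0)]
           (mod int p)"
proof -
  have "(\<Sum>t\<in>residue_set. \<Sum>i\<in>I. c i * t ^ e i) = (\<Sum>i\<in>I. c i * (\<Sum>t\<in>residue_set. t ^ e i))"
    by (subst sum.swap) (simp add: sum_distrib_left)
  also have "[\<dots> = (\<Sum>i\<in>I. c i * (if e i = 2 * m then -1 else 0))] (mod int p)"
    using assms(2) power_sum_residues p_eq by (intro cong_sum cong_mult cong_refl) simp
  also have "(\<Sum>i\<in>I. c i * (if e i = 2 * m then -1 else 0)) = - (\<Sum>i\<in>I. if e i = 2 * m then c i else 0)"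
    by (simp add: sum_negf[symmetric] if_distrib cong: if_cong)
  finally show ?thesis .
qed

text \<open>\<open>A\<close> collects known zeros of \<open>f\<close>. The bound serves to lift
  evaluations modulo \<open>p\<close> to equalities, via \<open>cong_imp_eq\<close>.\<close>

lemma abs_sum_chi_le:
  assumes "A \<subseteq> residue_set" and "\<And>t. t \<in> A \<Longrightarrow> int p dvd f t"
  shows "\<bar>\<Sum>t\<in>residue_set. chi (f t)\<bar> \<le> int p - int (card A)"
proof -
  have fin: "finite A"
    using assms(1) finite_subset by blast
  have "(\<Sum>t\<in>residue_set. chi (f t)) = (\<Sum>t\<in>residue_set - A. chi (f t))"
    using assms by (intro sum.mono_neutral_right) (auto simp: chi_eq_0_iff)
  also have "\<bar>\<dots>\<bar> \<le> (\<Sum>t\<in>residue_set - A. \<bar>chi (f t)\<bar>)"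
    by (rule sum_abs)
  also have "\<dots> \<le> (\<Sum>t\<in>residue_set - A. 1)"
    by (intro sum_mono chi_abs_le)
  also have "\<dots> = int (card (residue_set - A))"
    by simp
  also have "card (residue_set - A) = p - card A"
    using assms(1) fin by (simp add: card_Diff_subset)
  also have "int (p - card A) = int p - int (card A)"
    using card_mono[OF _ assms(1)] by simp
  finally show ?thesis .
qed

lemma cong_imp_eq: "[a = b] (mod int p) \<Longrightarrow> \<bar>a - b\<bar> < int p \<Longrightarrow> a = b"
  using not_dvd_small[of "a - b"] by (auto simp: cong_iff_dvd_diff)

lemma sum_chi: "(\<Sum>t\<in>residue_set. chi t) = 0"
proof (rule cong_imp_eq)
  show "[(\<Sum>t\<in>residue_set. chi t) = 0] (mod int p)"
    using cong_trans[OF sum_chi_cong[of "\<lambda>t. t"] power_sum_residues[of m]] m_pos p_eq by simp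
  show "\<bar>(\<Sum>t\<in>residue_set. chi t) - 0\<bar> < int p"
    using abs_sum_chi_le[of "{0}" "\<lambda>t. t"] p_gt_2 by simp
qed

lemma sum_chi_shift: "(\<Sum>t\<in>residue_set. chi (t - a)) = 0"
  using sum_residues_affine[of chi 1 "- a"] chi_cong sum_chi not_dvd_small[of 1] p_gt_2 by simp

text \<open>After a translation, Euler's criterion makes the sum congruent to minus the leading
  coefficient of \<open>(t * (t - c)) ^ m\<close>, of degree \<open>p - 1\<close>. The two zeros
  give absolute value at most \<open>p - 2\<close>, so \<open>-1\<close> is the only possible
  value.\<close>

lemma sum_chi_quadratic:
  assumes "\<not> int p dvd a - b"
  shows "(\<Sum>t\<in>residue_set. chi ((t - a) * (t - b))) = -1"
proof -
  define c where "c = a - b"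
  have "(\<Sum>t\<in>residue_set. chi ((t - a) * (t - b))) = (\<Sum>t\<in>residue_set. chi ((1 * t + b - a) * (1 * t + b - b)))"
    by (rule sum_residues_affine[symmetric])
      (use p_gt_2 not_dvd_small[of 1] in \<open>auto intro!: chi_cong cong_mult cong_diff\<close>)
  also have "\<dots> = (\<Sum>t\<in>residue_set. chi (t * (t - c)))"
    by (simp add: c_def algebra_simps)
  also have "\<dots> = -1"
  proof (rule cong_imp_eq)
    have "(t * (t - c)) ^ m = (\<Sum>i\<le>m. (of_nat (m choose i) * (- c) ^ (m - i)) * t ^ (m + i))" for t
      using binomial_ring[of t "- c" m]
      by (simp add: power_mult_distrib sum_distrib_left power_add mult_ac)
    then have "[(\<Sum>t\<in>residue_set. (t * (t - c)) ^ m) =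
        - (\<Sum>i\<le>m. if m + i = 2 * m then of_nat (m choose i) * (- c) ^ (m - i) else 0)] (mod int p)"
      using m_pos by (simp only:, intro sum_polynomial_cong) auto
    also have "(\<Sum>i\<le>m. if m + i = 2 * m then of_nat (m choose i) * (- c) ^ (m - i) else 0)
        = (\<Sum>i\<le>m. if i = m then 1 else 0)"
      by (intro sum.cong) auto
    finally show "[(\<Sum>t\<in>residue_set. chi (t * (t - c))) = -1] (mod int p)"
      using cong_trans[OF sum_chi_cong] by simp
    have "card {0, c mod int p} = 2"
      using assms by (auto simp: c_def card_2_iff dvd_eq_mod_eq_0)
    moreover have "int p dvd t * (t - c)" if "t \<in> {0, c mod int p}" for t
      using that by (auto simp: mod_eq_dvd_iff[symmetric] intro: dvd_mult)
    ultimately have "\<bar>\<Sum>t\<in>residue_set. chi (t * (t - c))\<bar> \<le> int p - 2"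
      using abs_sum_chi_le[of "{0, c mod int p}" "\<lambda>t. t * (t - c)"] p_gt_2 by simp
    then show "\<bar>(\<Sum>t\<in>residue_set. chi (t * (t - c))) - -1\<bar> < int p"
      by linarith
  qed
  finally show ?thesis .
qed

lemma sum_chi_square:
  assumes "int p dvd a - b"
  shows "(\<Sum>t\<in>residue_set. chi ((t - a) * (t - b))) = int p - 1"
proof -
  have "chi ((t - a) * (t - b)) = chi ((1 * t + (- a)) * (1 * t + (- a)))" for t
    by (intro chi_cong cong_mult cong_refl) (use assms in \<open>auto simp: cong_iff_dvd_diff\<close>)
  then have "(\<Sum>t\<in>residue_set. chi ((t - a) * (t - b)))
      = (\<Sum>t\<in>residue_set. chi ((1 * t + (- a)) * (1 * t + (- a))))"
    by simp
  also have "\<dots> = (\<Sum>t\<in>residue_set. chi (t * t))"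
    by (rule sum_residues_affine)
      (use p_gt_2 not_dvd_small[of 1] in \<open>auto intro!: chi_cong cong_mult\<close>)
  also have "\<dots> = (\<Sum>t\<in>residue_set - {0}. chi (t * t))"
    by (rule sum.mono_neutral_right) auto
  also have "\<dots> = (\<Sum>t\<in>residue_set - {0}. 1)"
    using not_dvd_small by (intro sum.cong) (auto simp: chi_mult chi_square)
  also have "\<dots> = int p - 1"
    using p_gt_2 by (simp add: card_Diff_subset)
  finally show ?thesis .
qed

subsection \<open>Jacobsthal sums\<close>

text \<open>\<open>p + jacobsthal k\<close> is the number of affine points of
  \<open>y^2 = t^3 - k t\<close> over the field with \<open>p\<close> elements.\<close>

definition jacobsthal :: "int \<Rightarrow> int" where
  "jacobsthal k = (\<Sum>t\<in>residue_set. chi (t * (t\<^sup>2 - k)))"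

lemma jacobsthal_cong: "[k = l] (mod int p) \<Longrightarrow> jacobsthal k = jacobsthal l"
  unfolding jacobsthal_def by (intro sum.cong refl chi_cong cong_mult cong_diff) auto

text \<open>Substituting \<open>u * t\<close> for \<open>t\<close> pulls out \<open>u ^ 3\<close>,
  whose symbol is \<open>chi u\<close>.\<close>

lemma jacobsthal_times_square:
  assumes "\<not> int p dvd u"
  shows "jacobsthal (k * u\<^sup>2) = chi u * jacobsthal k"
proof -
  have "chi ((u * t + 0) * ((u * t + 0)\<^sup>2 - k * u\<^sup>2)) = chi u * chi (t * (t\<^sup>2 - k))" for t
  proof -
    have "(u * t + 0) * ((u * t + 0)\<^sup>2 - k * u\<^sup>2) = (u * u) * (u * (t * (t\<^sup>2 - k)))"
      by (simp add: power2_eq_square algebra_simps)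
    then have "chi ((u * t + 0) * ((u * t + 0)\<^sup>2 - k * u\<^sup>2)) = (chi u * chi u) * (chi u * chi (t * (t\<^sup>2 - k)))"
      by (simp only: chi_mult)
    then show ?thesis
      using chi_square[OF assms] by simp
  qed
  moreover have "jacobsthal (k * u\<^sup>2) = (\<Sum>t\<in>residue_set. chi ((u * t + 0) * ((u * t + 0)\<^sup>2 - k * u\<^sup>2)))"
    unfolding jacobsthal_def
    by (rule sum_residues_affine[symmetric])
      (use assms in \<open>auto intro!: chi_cong cong_mult cong_diff cong_pow\<close>)
  ultimately show ?thesis
    by (simp add: jacobsthal_def sum_distrib_left)
qed

lemma jacobsthal_sqr_times_square:
  "\<not> int p dvd u \<Longrightarrow> (jacobsthal (k * u\<^sup>2))\<^sup>2 = (jacobsthal k)\<^sup>2"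
  using chi_square[of u] by (simp add: jacobsthal_times_square power_mult_distrib power2_eq_square[of "chi u"])

lemma jacobsthal_0: "jacobsthal 0 = 0"
proof -
  have "chi (t * (t\<^sup>2 - 0)) = chi t" for t
    using chi_cases[of t] by (auto simp: chi_mult power2_eq_square)
  then show ?thesis
    using sum_chi by (simp add: jacobsthal_def)
qed

lemma jacobsthal_sqr_residue:
  assumes "chi k = 1"
  shows "(jacobsthal k)\<^sup>2 = (jacobsthal 1)\<^sup>2"
proof -
  obtain y where y: "[y\<^sup>2 = k] (mod int p)"
    using assms by (auto simp: Legendre_def QuadRes_def split: if_splits)
  moreover have "\<not> int p dvd y"
    using y assms chi_cong[OF y] by (auto simp: chi_mult power2_eq_square chi_eq_0_iff[of y, symmetric])
  ultimately show ?thesis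
    using jacobsthal_sqr_times_square[of y 1] jacobsthal_cong[OF y] by simp
qed

text \<open>\<open>k * g\<close> is a square \<open>y^2\<close> modulo \<open>p\<close>, so
  \<open>g * y^2\<close> and \<open>k * g^2\<close> agree: one is a square multiple of
  \<open>g\<close>, the other of \<open>k\<close>.\<close>

lemma jacobsthal_sqr_nonresidue:
  assumes k: "chi k = -1" and g: "chi g = -1"
  shows "(jacobsthal k)\<^sup>2 = (jacobsthal g)\<^sup>2"
proof -
  have kg: "chi (k * g) = 1"
    using k g by (simp add: chi_mult)
  then obtain y where y: "[y\<^sup>2 = k * g] (mod int p)"
    by (auto simp: Legendre_def QuadRes_def split: if_splits)
  have ny: "\<not> int p dvd y"
    using kg chi_cong[OF y] by (auto simp: chi_mult power2_eq_square chi_eq_0_iff[of y, symmetric])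
  have ng: "\<not> int p dvd g"
    using g by (simp add: chi_eq_0_iff[symmetric])
  have "[g * y\<^sup>2 = g * (k * g)] (mod int p)"
    using y by (intro cong_mult) auto
  then have "jacobsthal (g * y\<^sup>2) = jacobsthal (k * g\<^sup>2)"
    using jacobsthal_cong by (simp add: power2_eq_square mult_ac)
  then show ?thesis
    using jacobsthal_sqr_times_square[OF ny, of g] jacobsthal_sqr_times_square[OF ng, of k] by simp
qed

text \<open>The weights \<open>1 \<plusminus> chi k\<close> select the residue class without counting residues.\<close>

lemma sum_jacobsthal_sqr_classes:
  assumes g: "chi g = -1"
  shows "2 * (\<Sum>k\<in>residue_set. (jacobsthal k)\<^sup>2) = (int p - 1) * ((jacobsthal 1)\<^sup>2 + (jacobsthal g)\<^sup>2)"
proof -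
  let ?A = "(jacobsthal 1)\<^sup>2" and ?B = "(jacobsthal g)\<^sup>2"
  have "2 * (jacobsthal k)\<^sup>2 = (?A + ?B) + chi k * (?A - ?B)" if "k \<in> residue_set - {0}" for k
  proof -
    have "chi k \<noteq> 0"
      using that not_dvd_small[of k] by (auto simp: chi_eq_0_iff)
    then consider "chi k = 1" | "chi k = -1"
      using chi_cases[of k] by auto
    then show ?thesis
      using jacobsthal_sqr_residue[of k] jacobsthal_sqr_nonresidue[OF _ g, of k] by cases auto
  qed
  then have "(\<Sum>k\<in>residue_set - {0}. 2 * (jacobsthal k)\<^sup>2)
      = (\<Sum>k\<in>residue_set - {0}. (?A + ?B) + chi k * (?A - ?B))"
    by (rule sum.cong[OF refl])
  also have "\<dots> = (\<Sum>k\<in>residue_set - {0}. ?A + ?B) + (\<Sum>k\<in>residue_set - {0}. chi k) * (?A - ?B)"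
    by (simp add: sum.distrib sum_distrib_right)
  also have "(\<Sum>k\<in>residue_set - {0}. chi k) = (\<Sum>k\<in>residue_set. chi k)"
    by (rule sum.mono_neutral_left) auto
  also have "(\<Sum>k\<in>residue_set - {0}. ?A + ?B) = (int p - 1) * (?A + ?B)"
    using p_gt_2 by (simp add: card_Diff_subset of_nat_diff)
  also have "(\<Sum>k\<in>residue_set - {0}. 2 * (jacobsthal k)\<^sup>2) = (\<Sum>k\<in>residue_set. 2 * (jacobsthal k)\<^sup>2)"
    by (rule sum.mono_neutral_left) (auto simp: jacobsthal_0)
  finally show ?thesis
    by (simp add: sum_chi sum_distrib_left)
qed

text \<open>For nonzero \<open>s\<close> only \<open>t = s\<close> and \<open>t = p - s\<close>
  contribute, and for even \<open>m\<close> the symbol of \<open>-1\<close> is 1, so each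
  contributes \<open>chi s * chi s = 1\<close>.\<close>

lemma sum_chi_same_square:
  assumes "even m" and s: "s \<in> residue_set"
  shows "(\<Sum>t\<in>residue_set. chi s * chi t * of_bool (int p dvd s\<^sup>2 - t\<^sup>2)) = (if s = 0 then 0 else 2)"
proof (cases "s = 0")
  case False
  have s': "0 < s" "s < int p"
    using s False by auto
  have "int p dvd s\<^sup>2 - t\<^sup>2 \<longleftrightarrow> t = s \<or> t = int p - s" if t: "t \<in> residue_set" for t
  proof -
    have "s\<^sup>2 - t\<^sup>2 = (s - t) * (s + t)"
      by (simp add: power2_eq_square algebra_simps)
    then have "int p dvd s\<^sup>2 - t\<^sup>2 \<longleftrightarrow> int p dvd s - t \<or> int p dvd s + t"
      using prime_int_p by (simp add: prime_dvd_mult_iff)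
    moreover have small: "\<bar>s - t\<bar> < int p" "\<bar>s + t - int p\<bar> < int p"
      using s' t by auto
    then have "int p dvd s - t \<longleftrightarrow> t = s"
      using not_dvd_small[of "s - t"] by auto
    moreover have "int p dvd s + t \<longleftrightarrow> int p dvd s + t - int p"
      using dvd_add_left_iff[of "int p" "- int p" "s + t"] by simp
    moreover have "int p dvd s + t - int p \<longleftrightarrow> t = int p - s"
      using not_dvd_small[of "s + t - int p"] small by (cases "s + t = int p") auto
    ultimately show ?thesis
      by blast
  qed
  then have "(\<Sum>t\<in>residue_set. chi s * chi t * of_bool (int p dvd s\<^sup>2 - t\<^sup>2))
      = (\<Sum>t\<in>residue_set. chi s * chi t * of_bool (t = s \<or> t = int p - s))"
    by (intro sum.cong) auto
  also have "\<dots> = (\<Sum>t\<in>{s, int p - s}. chi s * chi t)"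
    using s' by (intro sum.mono_neutral_cong_right) auto
  also have "\<dots> = chi s * chi s + chi s * chi (int p - s)"
    using p_eq s' by (subst sum.insert) (auto, presburger)
  also have "chi (int p - s) = chi ((-1) * s)"
    by (rule chi_cong) (simp add: cong_iff_dvd_diff)
  also have "\<dots> = chi s"
    unfolding chi_mult chi_minus_1 using \<open>even m\<close> by simp
  also have "chi s * chi s = 1"
    using s' not_dvd_small[of s] by (intro chi_square) auto
  finally show ?thesis
    using False by simp
qed simp

text \<open>Expanding the square and summing over \<open>k\<close> first leaves quadratic character
  sums, equal to \<open>p - 1\<close> if \<open>s^2 = t^2\<close> modulo \<open>p\<close> and to
  \<open>-1\<close> otherwise. The constant \<open>-1\<close> cancels because \<open>chi\<close>
  sums to 0, and the pairs \<open>t = \<plusminus> s\<close> remain.\<close>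

lemma sum_jacobsthal_sqr:
  assumes "even m"
  shows "(\<Sum>k\<in>residue_set. (jacobsthal k)\<^sup>2) = 2 * int p * (int p - 1)"
proof -
  have inner: "(\<Sum>k\<in>residue_set. chi ((s\<^sup>2 - k) * (t\<^sup>2 - k))) = int p * of_bool (int p dvd s\<^sup>2 - t\<^sup>2) - 1" for s t
  proof -
    have "(s\<^sup>2 - k) * (t\<^sup>2 - k) = (k - s\<^sup>2) * (k - t\<^sup>2)" for k
      by (simp add: algebra_simps)
    then show ?thesis
      using sum_chi_quadratic[of "s\<^sup>2" "t\<^sup>2"] sum_chi_square[of "s\<^sup>2" "t\<^sup>2"] by simp
  qed
  have "(\<Sum>k\<in>residue_set. (jacobsthal k)\<^sup>2)
      = (\<Sum>k\<in>residue_set. \<Sum>s\<in>residue_set. \<Sum>t\<in>residue_set. chi s * chi t * chi ((s\<^sup>2 - k) * (t\<^sup>2 - k)))"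
    unfolding jacobsthal_def power2_eq_square[of "sum _ _"] sum_product
    by (intro sum.cong refl) (simp add: chi_mult)
  also have "\<dots> = (\<Sum>s\<in>residue_set. \<Sum>k\<in>residue_set. \<Sum>t\<in>residue_set. chi s * chi t * chi ((s\<^sup>2 - k) * (t\<^sup>2 - k)))"
    by (rule sum.swap)
  also have "\<dots> = (\<Sum>s\<in>residue_set. \<Sum>t\<in>residue_set. \<Sum>k\<in>residue_set. chi s * chi t * chi ((s\<^sup>2 - k) * (t\<^sup>2 - k)))"
    by (rule sum.cong[OF refl], rule sum.swap)
  also have "\<dots> = (\<Sum>s\<in>residue_set. \<Sum>t\<in>residue_set. chi s * chi t * (int p * of_bool (int p dvd s\<^sup>2 - t\<^sup>2) - 1))"
    by (simp only: sum_distrib_left[symmetric] inner)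
  also have "\<dots> = (\<Sum>s\<in>residue_set. int p * (\<Sum>t\<in>residue_set. chi s * chi t * of_bool (int p dvd s\<^sup>2 - t\<^sup>2))
      - chi s * (\<Sum>t\<in>residue_set. chi t))"
    by (simp add: sum_distrib_left sum_subtractf algebra_simps)
  also have "\<dots> = (\<Sum>s\<in>residue_set. int p * (if s = 0 then 0 else 2))"
    by (intro sum.cong refl) (simp only: sum_chi_same_square[OF assms] sum_chi mult_zero_right diff_0_right)
  also have "\<dots> = (\<Sum>s\<in>residue_set - {0}. int p * 2)"
    by (rule sum.mono_neutral_cong_right) auto
  also have "\<dots> = 2 * int p * (int p - 1)"
    using p_gt_2 by (simp add: card_Diff_subset of_nat_diff)
  finally show ?thesis .
qed

lemma exists_nonresidue: "\<exists>g. chi g = -1"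
proof (rule ccontr)
  assume "\<not> ?thesis"
  then have "chi t \<ge> 0" for t
    using chi_cases[of t] by auto
  then have "chi 1 \<le> (\<Sum>t\<in>residue_set. chi t)"
    using p_gt_2 by (intro member_le_sum) auto
  then show False
    by (simp add: sum_chi)
qed

text \<open>The two evaluations of the second moment are compared; \<open>b\<close> is the
  Jacobsthal sum of a nonresidue.\<close>

lemma jacobsthal_sum_of_squares:
  assumes "even m"
  obtains b where "(jacobsthal 1)\<^sup>2 + b\<^sup>2 = 4 * int p"
proof -
  obtain g where g: "chi g = -1"
    using exists_nonresidue by blast
  have "(int p - 1) * ((jacobsthal 1)\<^sup>2 + (jacobsthal g)\<^sup>2) = (int p - 1) * (4 * int p)"
    using sum_jacobsthal_sqr_classes[OF g] unfolding sum_jacobsthal_sqr[OF assms] by (simp only: mult_ac)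
  then show ?thesis
    using that p_gt_2 by simp
qed

text \<open>Each product \<open>(1 + chi t) (1 + chi (t - 1)) (1 + chi (t + 1))\<close> with three nonzero symbols is
  \<open>0\<close> or \<open>8\<close>, and expanding the sum of these products leaves \<open>jacobsthal 1\<close> as the only
  unknown term.\<close>

lemma jacobsthal_1_mod_8:
  assumes "even m"
  shows "[jacobsthal 1 = 7 - int p] (mod 8)"
proof -
  define F where "F t = (1 + chi t) * (1 + chi (t - 1)) * (1 + chi (t + 1))" for t
  have "m \<noteq> 1"
    using assms by auto
  then have p5: "int p \<ge> 5"
    using m_pos p_eq by simp
  have minus1: "chi (-1) = 1"
    using assms by (simp add: chi_minus_1)
  have pm1: "chi (int p - 1) = 1" "chi (int p - 1 - 1) = chi 2" "chi (int p - 1 + 1) = 0"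
    using chi_cong[of "int p - 1" "-1"] chi_cong[of "int p - 1 - 1" "-1 * 2"] minus1
    unfolding chi_mult by (auto simp: cong_iff_dvd_diff chi_eq_0_iff)
  have c2: "chi 2 = 1 \<or> chi 2 = -1"
    using chi_cases[of 2] chi_eq_0_iff[of 2] not_dvd_small[of 2] p5 by auto
  have one: "\<not> int p dvd 1" "\<not> int p dvd 2"
    using not_dvd_small[of 1] not_dvd_small[of 2] p5 by auto
  have "F t = 1 + chi (t - 0) + chi (t - 1) + chi (t - (-1)) + chi ((t - 0) * (t - 1))
      + chi ((t - 0) * (t - (-1))) + chi ((t - 1) * (t - (-1))) + chi (t * (t\<^sup>2 - 1))" for t
  proof -
    have "t\<^sup>2 - 1 = (t - 1) * (t + 1)"
      by (simp add: power2_eq_square algebra_simps)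
    then show ?thesis
      by (simp only: F_def chi_mult diff_0_right diff_minus_eq_add) (simp add: algebra_simps)
  qed
  then have "(\<Sum>t\<in>residue_set. F t) = int p + 0 + 0 + 0 + (-1) + (-1) + (-1) + jacobsthal 1"
    unfolding jacobsthal_def
    using sum_chi_quadratic[of 0 1] sum_chi_quadratic[of 0 "-1"] sum_chi_quadratic[of 1 "-1"]
      sum_chi_shift[of 0] sum_chi_shift[of 1] sum_chi_shift[of "-1"] one
    by (simp only: sum.distrib) simp
  moreover have "(\<Sum>t\<in>residue_set. F t) = F 0 + F 1 + F (int p - 1) + (\<Sum>t\<in>residue_set - {0, 1, int p - 1}. F t)"
    using p5 by (subst sum.subset_diff[of "{0, 1, int p - 1}"]) auto
  moreover have "F 0 = 4" "F 1 = 2 * (1 + chi 2)" "F (int p - 1) = 2 * (1 + chi 2)"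
    unfolding F_def pm1 by (simp_all add: minus1)
  moreover have "8 dvd (\<Sum>t\<in>residue_set - {0, 1, int p - 1}. F t)"
  proof (rule dvd_sum)
    fix t assume t: "t \<in> residue_set - {0, 1, int p - 1}"
    have "chi t \<noteq> 0" "chi (t - 1) \<noteq> 0" "chi (t + 1) \<noteq> 0"
      using t not_dvd_small[of t] not_dvd_small[of "t - 1"] not_dvd_small[of "t + 1"]
      by (auto simp: chi_eq_0_iff)
    then show "8 dvd F t"
      unfolding F_def using chi_cases[of t] chi_cases[of "t - 1"] chi_cases[of "t + 1"] by auto
  qed
  \<comment> \<open>\<open>F 1 + F (int p - 1) = 4 * (1 + chi 2)\<close> is 0 or 8, so only
    \<open>F 0 = 4\<close> survives modulo 8: \<open>int p - 3 + jacobsthal 1\<close> is congruent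
    to 4.\<close>
  ultimately show ?thesis
    using c2 unfolding cong_iff_dvd_diff by presburger
qed

subsection \<open>Gauss's congruence for the central binomial coefficient\<close>

text \<open>By Euler's criterion the sum is minus the coefficient of \<open>t ^ (p - 1)\<close> in
  \<open>(t^3 - t) ^ m\<close>, which sits at \<open>i = n\<close> only.\<close>

lemma jacobsthal_1_cong:
  assumes "m = 2 * n"
  shows "[jacobsthal 1 = - ((-1) ^ n * int (m choose n))] (mod int p)"
proof -
  have "(t * (t\<^sup>2 - 1)) ^ m = (\<Sum>i\<le>m. (int (m choose i) * (-1) ^ (m - i)) * t ^ (m + 2 * i))" for t :: int
    using binomial_ring[of "t\<^sup>2" "-1" m]
    by (simp add: power_mult_distrib sum_distrib_left power_add mult_ac power_mult[symmetric])
  then have "[(\<Sum>t\<in>residue_set. (t * (t\<^sup>2 - 1)) ^ m) =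
      - (\<Sum>i\<le>m. if m + 2 * i = 2 * m then int (m choose i) * (-1) ^ (m - i) else 0)] (mod int p)"
    using m_pos by (simp only:, intro sum_polynomial_cong) auto
  also have "(\<Sum>i\<le>m. if m + 2 * i = 2 * m then int (m choose i) * (-1) ^ (m - i) else 0)
      = (\<Sum>i\<le>m. if i = n then int (m choose i) * (-1) ^ (m - i) else 0)"
    using assms by (intro sum.cong) auto
  also have "\<dots> = (-1) ^ n * int (m choose n)"
    using assms by simp
  finally show ?thesis
    using cong_trans[OF sum_chi_cong[of "\<lambda>t. t * (t\<^sup>2 - 1)"]] unfolding jacobsthal_def by simp
qed

text \<open>\<open>jacobsthal 1 = 2 * a\<close> where \<open>a\<close> is the odd part of a
  representation of \<open>p\<close> as a sum of two squares, hence
  \<open>a = \<plusminus> x\<close> by uniqueness; the value modulo 8 decides the sign.\<close>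

theorem gauss_central_binomial:
  assumes m: "m = 2 * n" and xy: "int p = x\<^sup>2 + y\<^sup>2" "4 dvd x - 1" "even y"
  shows "[int (m choose n) = 2 * x] (mod int p)"
proof -
  have "even m"
    using m by simp
  obtain b where b: "(jacobsthal 1)\<^sup>2 + b\<^sup>2 = 4 * int p"
    using jacobsthal_sum_of_squares[OF \<open>even m\<close>] .
  have p4: "int p = 4 * int n + 1"
    using p_eq m by simp
  have mod8: "8 dvd jacobsthal 1 - (7 - int p)"
    using jacobsthal_1_mod_8[OF \<open>even m\<close>] by (simp add: cong_iff_dvd_diff)
  then have "even (jacobsthal 1)"
    using p4 by presburger
  then obtain a where a: "jacobsthal 1 = 2 * a"
    by blast
  \<comment> \<open>Modulo 8, \<open>2 * a\<close> is \<open>7 - p = 6 - 4 * n\<close>; this is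
    halved.\<close>
  have a4: "4 dvd a - 3 + 2 * int n"
    using mod8 p4 a by presburger
  have "even b"
    using b a by (metis dvd_add_right_iff even_mult_iff even_numeral even_power zero_less_numeral pos2)
  then obtain c where c: "b = 2 * c" by auto
  have ac: "int p = a\<^sup>2 + c\<^sup>2"
    using b unfolding a c by (simp add: power_mult_distrib)
  have "odd a" using a4 by presburger
  then have "even c"
    using ac p4 by (metis even_add even_mult_iff even_numeral even_power odd_one pos2)
  have "a\<^sup>2 = x\<^sup>2"
    using sum_two_squares_odd_part_unique[OF prime_int_p _ ac xy(1)] \<open>even c\<close> xy(3) p4 by simp
  then have "a = x \<or> a = - x"
    by (simp add: power2_eq_iff)
  \<comment> \<open>Modulo 4, \<open>x\<close> is 1 and \<open>a\<close> is
    \<open>3 - 2 * n\<close>, that is \<open>- ((-1) ^ n)\<close>.\<close>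
  then have "a = - ((-1) ^ n * x)"
    using a4 xy(2) by (cases "even n") (auto; presburger)+
  then have "[- ((-1) ^ n * (2 * x)) = - ((-1) ^ n * int (m choose n))] (mod int p)"
    using jacobsthal_1_cong[OF m] a by (simp add: mult_ac)
  then show ?thesis
    by (cases "even n") (auto simp: cong_minus_minus_iff cong_sym_eq)
qed

end

section \<open>Identities for binomial coefficients\<close>

text \<open>This trades the product occurring in the sum for the coefficients that arise from
  expanding the power \<open>m - 1\<close> of a quadratic polynomial; absorbing the weight
  \<open>k\<close> lowers \<open>m\<close> to \<open>m - 1\<close>.\<close>

lemma choose_double_identity:
  assumes "0 < k"
  shows "k * (m choose (2 * k)) * ((2 * k) choose k) = m * ((m - 1) choose (m - k)) * ((m - k) choose k)"
proof (cases "2 * k \<le> m")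
  case True
  have "(m choose (2 * k)) * ((2 * k) choose k) = (m choose k) * ((m - k) choose k)"
    using choose_mult[of k "2 * k" m] True by simp
  moreover have "k * (m choose k) = m * ((m - 1) choose (k - 1))"
    using assms by (rule times_binomial_minus1_eq)
  moreover have "(m - 1) choose (k - 1) = (m - 1) choose (m - k)"
    using binomial_symmetric[of "k - 1" "m - 1"] True assms by simp
  ultimately show ?thesis
    by (metis mult.assoc)
next
  case False
  then have "m < 2 * k" "m - k < k"
    using assms by auto
  then show ?thesis
    by (simp add: binomial_eq_0)
qed

lemma central_binomial_eq_double:
  assumes "0 < h"
  shows "(2 * h) choose h = 2 * ((2 * h - 1) choose h)"
proof -
  have "h * ((2 * h) choose h) = h * (2 * ((2 * h - 1) choose (h - 1)))"
    using times_binomial_minus1_eq[OF assms, of "2 * h"] by auto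
  moreover have "(2 * h - 1) choose (h - 1) = (2 * h - 1) choose h"
    using binomial_symmetric[of "h - 1" "2 * h - 1"] assms by simp
  ultimately show ?thesis
    using assms by simp
qed

text \<open>For \<open>m = 2 * h - 1\<close> this relates \<open>(m - 1) choose h\<close> to the
  central coefficient and is the source of the factor 3/4.\<close>

lemma central_binomial_reduce:
  assumes "0 < h"
  shows "(h - 1) * ((2 * h) choose h) = 2 * (2 * h - 1) * ((2 * h - 2) choose h)"
proof -
  have "2 * h - 1 - h = h - 1" "2 * h - 1 - 1 = 2 * h - 2"
    by auto
  then have "(h - 1) * ((2 * h - 1) choose h) = (2 * h - 1) * ((2 * h - 2) choose h)"
    using binomial_absorb_comp[of "2 * h - 1" h] by simp
  then show ?thesis
    unfolding central_binomial_eq_double[OF assms] by (metis mult.assoc mult.left_commute)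
qed

lemma times_choose_Suc: "Suc k * (n choose Suc k) = (n - k) * (n choose k)"
  by (simp only: binomial_absorption binomial_absorb_comp)

lemma Suc_times_central_binomial: "Suc j * ((2 * Suc j) choose Suc j) = 2 * (2 * j + 1) * ((2 * j) choose j)"
proof -
  have "(2 * Suc j) choose Suc j = 2 * (Suc (2 * j) choose Suc j)"
    using central_binomial_eq_double[of "Suc j"] by simp
  moreover have "Suc j * (Suc (2 * j) choose Suc j) = Suc (2 * j) * ((2 * j) choose j)"
    by (rule Suc_times_binomial)
  ultimately show ?thesis
    by (simp only: mult.left_commute[of "Suc j"]) simp
qed

context odd_prime
begin

subsection \<open>Reduction to a polynomial sum modulo p\<close>

text \<open>Exactly, \<open>(2 * j) choose j\<close> is \<open>(-4) ^ j\<close> times the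
  generalised binomial coefficient of \<open>-1/2\<close> over \<open>j\<close>, and
  \<open>m\<close> is congruent to \<open>-1/2\<close>. The proof compares the two recurrences,
  where \<open>Suc j\<close> can be cancelled as it stays below \<open>p\<close>.\<close>

lemma central_binomial_cong:
  assumes "j < p"
  shows "[int ((2 * j) choose j) = (-4) ^ j * int (m choose j)] (mod int p)"
  using assms
proof (induction j)
  case (Suc j)
  have "int (Suc j) * int ((2 * Suc j) choose Suc j) = (4 * int j + 2) * int ((2 * j) choose j)"
    unfolding of_nat_mult[symmetric] Suc_times_central_binomial by (simp add: algebra_simps)
  also have "[\<dots> = (4 * int j + 2) * ((-4) ^ j * int (m choose j))] (mod int p)"
    using Suc by (intro cong_mult cong_refl) simp
  \<comment> \<open>The difference of the two linear factors is
    \<open>4 * m + 2 = 2 * p\<close>.\<close>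
  also have "[(4 * int j + 2) * ((-4) ^ j * int (m choose j))
      = (-4 * (int m - int j)) * ((-4) ^ j * int (m choose j))] (mod int p)"
    by (intro cong_mult cong_refl, unfold cong_iff_dvd_diff, rule dvdI[of _ _ 2]) (simp add: p_eq)
  also have "(-4 * (int m - int j)) * ((-4) ^ j * int (m choose j))
      = (-4) ^ Suc j * ((int m - int j) * int (m choose j))"
    by (simp only: power_Suc mult_ac)
  \<comment> \<open>For \<open>j > m\<close>, where natural subtraction truncates, both binomial
    coefficients vanish.\<close>
  also have "(int m - int j) * int (m choose j) = int (Suc j) * int (m choose Suc j)"
    using times_choose_Suc[of j m, THEN arg_cong[of _ _ int]]
    by (cases "j \<le> m") (simp_all add: of_nat_diff algebra_simps binomial_eq_0)
  also have "(-4) ^ Suc j * (int (Suc j) * int (m choose Suc j))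
      = int (Suc j) * ((-4) ^ Suc j * int (m choose Suc j))"
    by (rule mult.left_commute)
  finally have "[int (Suc j) * int ((2 * Suc j) choose Suc j)
      = int (Suc j) * ((-4) ^ Suc j * int (m choose Suc j))] (mod int p)" .
  moreover have "coprime (int (Suc j)) (int p)"
    using Suc.prems by (intro coprime_pI not_dvd_small) auto
  ultimately show ?case
    using cong_mult_lcancel by blast
qed simp

lemma dvd_central_binomial:
  assumes "p \<le> 2 * k" "k < p"
  shows "p dvd (2 * k) choose k"
proof -
  have "p dvd fact k * fact k * ((2 * k) choose k)"
    using binomial_fact_lemma[of k "2 * k"] assms prime_dvd_fact_iff[OF prime_p, of "2 * k"] by simp
  then show ?thesis
    using assms prime_p by (simp add: prime_dvd_mult_iff prime_dvd_fact_iff)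
qed

lemma binomial_product_cong:
  assumes "k < p"
  shows "[int ((4 * k) choose (2 * k)) * int ((2 * k) choose k)
      = 16 ^ k * int (m choose (2 * k)) * int ((2 * k) choose k)] (mod int p)"
proof (cases "p \<le> 2 * k")
  case True
  then have "[int ((2 * k) choose k) = 0] (mod int p)"
    using dvd_central_binomial[OF True assms] by (simp add: cong_0_iff)
  then show ?thesis
    by (simp add: cong_0_iff cong_iff_dvd_diff)
next
  case False
  then have "[int ((4 * k) choose (2 * k)) = (-4) ^ (2 * k) * int (m choose (2 * k))] (mod int p)"
    using central_binomial_cong[of "2 * k"] by simp
  then show ?thesis
    by (intro cong_mult cong_refl) (simp add: power_mult)
qed

text \<open>With \<open>t = 3 * z\<close> the quadratic is nine times \<open>z^2 + z + 2/9\<close>.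
  The factor \<open>t ^ m\<close> moves the wanted coefficient of \<open>t ^ m\<close> to degree
  \<open>p - 1\<close>, where summation over residues detects it.\<close>

definition poly_sum :: int where
  "poly_sum = (\<Sum>t\<in>residue_set. t ^ m * (t\<^sup>2 + 3 * t + 2) ^ (m - 1))"

text \<open>The quadratic is expanded as \<open>t * (t + 3) + 2\<close>: \<open>c\<close> counts
  factors \<open>t * (t + 3)\<close>, and \<open>a\<close> the factors \<open>t\<close> taken from
  \<open>(t + 3) ^ c\<close>. Degree \<open>p - 1\<close> forces \<open>a = m - c\<close>, and
  \<open>k = m - c\<close> recovers the sum.\<close>

lemma weighted_sum_cong:
  "[(\<Sum>k<p. int k * int (m choose (2 * k)) * int ((2 * k) choose k) * 2 ^ k * 3 ^ (m - 2 * k)) = poly_sum]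
     (mod int p)"
proof -
  let ?M = "m - 1"
  define f where "f c a = int (?M choose c) * int (c choose a) * 2 ^ (?M - c) * 3 ^ (c - a)" for c a
  define w where "w k = int (?M choose (m - k)) * int ((m - k) choose k) * 2 ^ (k - 1) * 3 ^ (m - 2 * k)" for k
  let ?I = "SIGMA c:{..?M}. {..c}"
  have expand: "t ^ m * (t\<^sup>2 + 3 * t + 2) ^ ?M = (\<Sum>i\<in>?I. case_prod f i * t ^ (m + fst i + snd i))" for t
  proof -
    have "t\<^sup>2 + 3 * t + 2 = t * (t + 3) + 2"
      by (simp add: power2_eq_square algebra_simps)
    then have "(t\<^sup>2 + 3 * t + 2) ^ ?M = (\<Sum>c\<le>?M. int (?M choose c) * (t * (t + 3)) ^ c * 2 ^ (?M - c))"
      by (simp only: binomial_ring)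
    also have "\<dots> = (\<Sum>c\<le>?M. int (?M choose c) * (t ^ c * (\<Sum>a\<le>c. int (c choose a) * t ^ a * 3 ^ (c - a))) * 2 ^ (?M - c))"
      by (simp only: power_mult_distrib binomial_ring)
    also have "\<dots> = (\<Sum>c\<le>?M. \<Sum>a\<le>c. f c a * t ^ (c + a))"
      by (simp add: f_def sum_distrib_left sum_distrib_right power_add mult_ac)
    finally show ?thesis
      by (simp add: sum_distrib_left sum.Sigma case_prod_beta power_add mult_ac)
  qed
  have "[poly_sum = - (\<Sum>i\<in>?I. if m + fst i + snd i = 2 * m then case_prod f i else 0)] (mod int p)"
    unfolding poly_sum_def expand using m_pos by (intro sum_polynomial_cong) auto
  also have "(\<Sum>i\<in>?I. if m + fst i + snd i = 2 * m then case_prod f i else 0)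
      = (\<Sum>c\<le>?M. \<Sum>a\<le>c. if a = m - c then f c a else 0)"
    using m_pos by (subst sum.Sigma) (auto simp: case_prod_beta intro!: sum.cong)
  \<comment> \<open>Terms with \<open>m - c > c\<close> are absent on the left and zero on the
    right.\<close>
  also have "\<dots> = (\<Sum>c\<le>?M. f c (m - c))"
    by (intro sum.cong refl) (auto simp: f_def)
  also have "\<dots> = (\<Sum>k\<in>{1..m}. w k)"
    using m_pos
    by (intro sum.reindex_bij_witness[of _ "\<lambda>k. m - k" "\<lambda>c. m - c"]) (auto simp: f_def w_def mult_2)
  finally have 1: "[poly_sum = - (\<Sum>k\<in>{1..m}. w k)] (mod int p)" .
  \<comment> \<open>The weight removes \<open>k = 0\<close>, and \<open>m choose (2 * k)\<close>
    vanishes for \<open>k > m\<close>.\<close>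
  have "(\<Sum>k<p. int k * int (m choose (2 * k)) * int ((2 * k) choose k) * 2 ^ k * 3 ^ (m - 2 * k))
      = (\<Sum>k\<in>{1..m}. int k * int (m choose (2 * k)) * int ((2 * k) choose k) * 2 ^ k * 3 ^ (m - 2 * k))"
    using p_eq by (intro sum.mono_neutral_right) (auto simp: not_le)
  also have "\<dots> = (\<Sum>k\<in>{1..m}. 2 * int m * w k)"
  proof (intro sum.cong refl)
    fix k assume k: "k \<in> {1..m}"
    have "int k * int (m choose (2 * k)) * int ((2 * k) choose k)
        = int m * int (?M choose (m - k)) * int ((m - k) choose k)"
      using choose_double_identity[of k m] k by (simp only: of_nat_mult[symmetric]) auto
    moreover have "(2::int) ^ k = 2 * 2 ^ (k - 1)"
      using k by (cases k) auto
    ultimately show "int k * int (m choose (2 * k)) * int ((2 * k) choose k) * 2 ^ k * 3 ^ (m - 2 * k) = 2 * int m * w k"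
      by (simp add: w_def)
  qed
  also have "\<dots> = 2 * int m * (\<Sum>k\<in>{1..m}. w k)"
    by (simp add: sum_distrib_left)
  \<comment> \<open>\<open>2 * m = p - 1\<close> supplies the sign that cancels the minus from the
    power sum.\<close>
  also have "[\<dots> = -1 * (\<Sum>k\<in>{1..m}. w k)] (mod int p)"
    by (intro cong_mult cong_refl, unfold cong_iff_dvd_diff, rule dvdI[of _ _ 1]) (simp add: p_eq)
  finally show ?thesis
    using cong_trans[OF _ cong_sym[OF 1]] by simp
qed

text \<open>The roots \<open>0, -1, -2\<close> of \<open>t (t\<^sup>2 + 3 t + 2)\<close> are an arithmetic progression, so the
  translation by \<open>1\<close> makes it the odd polynomial \<open>t\<^sup>3 - t\<close>.\<close>

lemma poly_sum_shift:
  "[poly_sum = - (\<Sum>i\<le>m - 1. if m + 2 * i = 2 * m then int ((m - 1) choose i) * (-1) ^ (m - 1 - i) else 0)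
      + (\<Sum>i\<le>m - 1. if m - 1 + 2 * i = 2 * m then int ((m - 1) choose i) * (-1) ^ (m - 1 - i) else 0)]
     (mod int p)"
proof -
  let ?M = "m - 1"
  let ?f = "\<lambda>t::int. t ^ m * (t\<^sup>2 + 3 * t + 2) ^ ?M"
  let ?c = "\<lambda>i. int (?M choose i) * (-1) ^ (?M - i)"
  have f: "?f (1 * t + - 1) = (\<Sum>i\<le>?M. ?c i * t ^ (m + 2 * i)) - (\<Sum>i\<le>?M. ?c i * t ^ (?M + 2 * i))" for t
  proof -
    have bin: "(t\<^sup>2 - 1) ^ ?M = (\<Sum>i\<le>?M. ?c i * t ^ (2 * i))"
      using binomial_ring[of "t\<^sup>2" "-1" ?M] by (simp add: power_mult[symmetric] mult_ac)
    have "(1 * t + - 1)\<^sup>2 + 3 * (1 * t + - 1) + 2 = t * (t + 1)"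
      by (simp add: power2_eq_square algebra_simps)
    moreover have "(1 * t + - 1) ^ m = (t - 1) * (t - 1) ^ ?M"
      using m_pos by (cases m) auto
    ultimately have "?f (1 * t + - 1) = (t - 1) * t ^ ?M * ((t - 1) * (t + 1)) ^ ?M"
      by (simp only: power_mult_distrib) (simp add: mult_ac)
    also have "(t - 1) * (t + 1) = t\<^sup>2 - 1"
      by (simp add: power2_eq_square algebra_simps)
    \<comment> \<open>The factor \<open>t - 1\<close> splits the polynomial into two parts of
      opposite degree parity, so only one can reach degree \<open>p - 1\<close>.\<close>
    also have "(t - 1) * t ^ ?M = t ^ m - t ^ ?M"
      using m_pos by (cases m) (auto simp: algebra_simps)
    finally show ?thesis
      unfolding bin left_diff_distrib sum_distrib_left
      by (simp only: power_add mult.left_commute sum_subtractf)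
  qed
  have "[(\<Sum>t\<in>residue_set. ?f (1 * t + - 1)) = poly_sum] (mod int p)"
    unfolding poly_sum_def
    by (rule cong_sum_residues_affine)
      (use p_gt_2 not_dvd_small[of 1] in \<open>auto intro!: cong_mult cong_add cong_pow\<close>)
  then have 1: "[poly_sum = (\<Sum>t\<in>residue_set. \<Sum>i\<le>?M. ?c i * t ^ (m + 2 * i))
      - (\<Sum>t\<in>residue_set. \<Sum>i\<le>?M. ?c i * t ^ (?M + 2 * i))] (mod int p)"
    unfolding f sum_subtractf by (rule cong_sym)
  have "[(\<Sum>t\<in>residue_set. \<Sum>i\<le>?M. ?c i * t ^ (m + 2 * i))
      - (\<Sum>t\<in>residue_set. \<Sum>i\<le>?M. ?c i * t ^ (?M + 2 * i))
    = - (\<Sum>i\<le>?M. if m + 2 * i = 2 * m then ?c i else 0)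
      - (- (\<Sum>i\<le>?M. if ?M + 2 * i = 2 * m then ?c i else 0))] (mod int p)"
    using m_pos by (intro cong_diff sum_polynomial_cong) auto
  from cong_trans[OF 1 this] show ?thesis
    by simp
qed

text \<open>For even \<open>m\<close> only the part with exponents \<open>m + 2 * i\<close> has even
  degrees; \<open>i = n\<close> remains, and doubling makes \<open>(m - 1) choose n\<close>
  central.\<close>

lemma poly_sum_even:
  assumes m: "m = 2 * n"
  shows "[2 * poly_sum = chi 2 * int (m choose n)] (mod int p)"
proof -
  have n: "n > 0" and n_le: "n \<le> m - 1"
    using m m_pos by auto
  have 1: "(\<Sum>i\<le>m - 1. if m + 2 * i = 2 * m then int ((m - 1) choose i) * (-1) ^ (m - 1 - i) else 0)
      = (\<Sum>i\<le>m - 1. if i = n then int ((m - 1) choose i) * (-1) ^ (m - 1 - i) else 0)"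
    using m by (intro sum.cong) auto
  have 2: "(\<Sum>i\<le>m - 1. if m - 1 + 2 * i = 2 * m then int ((m - 1) choose i) * (-1) ^ (m - 1 - i) else 0) = 0"
    using m n by (intro sum.neutral) (auto, presburger)
  have sign: "- ((-1::int) ^ (m - 1 - n)) = chi 2"
    using chi_2 m n by (cases n) auto
  have "[poly_sum = - (int ((m - 1) choose n) * (-1) ^ (m - 1 - n))] (mod int p)"
    using poly_sum_shift n_le unfolding 1 2 by simp
  then have "[poly_sum = int ((m - 1) choose n) * chi 2] (mod int p)"
    unfolding sign[symmetric] by simp
  then have "[2 * poly_sum = 2 * (int ((m - 1) choose n) * chi 2)] (mod int p)"
    by (intro cong_mult cong_refl)
  then show ?thesis
    using central_binomial_eq_double[OF n] m by (simp add: mult_ac)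
qed

text \<open>For odd \<open>m\<close> the part with exponents \<open>m - 1 + 2 * i\<close>
  contributes, at \<open>i = h\<close>; its coefficient is then related to the central one modulo
  \<open>p = 4 * h - 1\<close>.\<close>

lemma poly_sum_odd:
  assumes m: "m + 1 = 2 * h"
  shows "[4 * poly_sum = 3 * chi 2 * int ((2 * h) choose h)] (mod int p)"
proof -
  have h: "h > 0" and mh: "m = 2 * h - 1" "m - 1 = 2 * h - 2"
    using m by auto
  have 1: "(\<Sum>i\<le>m - 1. if m + 2 * i = 2 * m then int ((m - 1) choose i) * (-1) ^ (m - 1 - i) else 0) = 0"
    using m by (intro sum.neutral) (auto, presburger)
  have 2: "(\<Sum>i\<le>m - 1. if m - 1 + 2 * i = 2 * m then int ((m - 1) choose i) * (-1) ^ (m - 1 - i) else 0)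
      = (\<Sum>i\<le>m - 1. if i = h then int ((m - 1) choose i) * (-1) ^ (m - 1 - i) else 0)"
    using m m_pos by (intro sum.cong) auto
  have sign: "(-1::int) ^ (m - 1 - h) = chi 2" if "h \<le> m - 1"
  proof -
    have "2 \<le> h"
      using that mh h by simp
    then obtain j where "h = 2 + j"
      using le_Suc_ex by blast
    then show ?thesis
      using chi_2 mh by simp
  qed
  \<comment> \<open>If \<open>h > m - 1\<close>, which happens for \<open>m = 1\<close>, the index
    is out of range and the binomial coefficient is 0.\<close>
  have "[poly_sum = int ((m - 1) choose h) * chi 2] (mod int p)"
    using poly_sum_shift sign unfolding 1 2 by (cases "h \<le> m - 1") (auto simp: binomial_eq_0)
  then have "[4 * poly_sum = chi 2 * (4 * int ((m - 1) choose h))] (mod int p)"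
    using cong_mult[OF cong_refl[of 4]] by (fastforce simp: mult_ac)
  also have "[chi 2 * (4 * int ((m - 1) choose h)) = chi 2 * (3 * int ((2 * h) choose h))] (mod int p)"
  proof (rule cong_mult[OF cong_refl])
    have p4: "int p = 4 * int h - 1"
      using p_eq m by simp
    have "int (h - 1) * int ((2 * h) choose h) = 2 * int (2 * h - 1) * int ((m - 1) choose h)"
      unfolding mh(2) using central_binomial_reduce[OF h] by (simp only: of_nat_mult[symmetric]) simp
    then have "(int h - 1) * int ((2 * h) choose h) = (4 * int h - 2) * int ((m - 1) choose h)"
      using h by (simp add: of_nat_diff)
    \<comment> \<open>Four times the recurrence, read with \<open>4 * h = p + 1\<close>.\<close>
    then have "4 * int ((m - 1) choose h) - 3 * int ((2 * h) choose h)
        = int p * (4 * int ((m - 1) choose h) - int ((2 * h) choose h))"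
      unfolding p4 by (simp add: algebra_simps)
    then show "[4 * int ((m - 1) choose h) = 3 * int ((2 * h) choose h)] (mod int p)"
      by (simp add: cong_iff_dvd_diff)
  qed
  finally show ?thesis
    by (simp add: mult_ac)
qed

end

section \<open>Arithmetic of \<open>p\<close>-integral rationals and their congruences\<close>

text \<open>The reduced denominator divides the denominator of any representing fraction, so
  unreduced fractions can be used to prove integrality.\<close>

lemma p_integral_iff:
  assumes "prime p"
  shows "p_integral p a \<longleftrightarrow> (\<exists>n d. a = of_int n / of_int d \<and> \<not> int p dvd d)"
proof
  assume "p_integral p a"
  then show "\<exists>n d. a = of_int n / of_int d \<and> \<not> int p dvd d"
    using quotient_of_div[of a] by (metis p_integral_def prod.collapse)
next
  assume "\<exists>n d. a = of_int n / of_int d \<and> \<not> int p dvd d"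
  then obtain n d where a: "a = of_int n / of_int d" and d: "\<not> int p dvd d"
    by blast
  obtain r q where rq: "quotient_of a = (r, q)"
    by fastforce
  have "q > 0" "coprime r q" "a = of_int r / of_int q"
    using rq quotient_of_denom_pos quotient_of_coprime quotient_of_div by auto
  moreover have "d \<noteq> 0"
    using d by auto
  ultimately have "(of_int (n * q) :: rat) = of_int (r * d)"
    using a by (simp add: field_simps)
  then have "n * q = r * d"
    by (simp only: of_int_eq_iff)
  then have "q dvd r * d"
    by (metis dvd_triv_right)
  then have "q dvd d"
    using \<open>coprime r q\<close> by (simp add: coprime_commute coprime_dvd_mult_right_iff)
  then show "p_integral p a"
    unfolding p_integral_def rq using d dvd_trans by auto
qed

context
  fixes p :: nat
  assumes prime_p: "prime p"
begin

lemma p_integral_frac: "\<not> int p dvd d \<Longrightarrow> p_integral p (of_int n / of_int d)"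
  using p_integral_iff[OF prime_p] by blast

lemma p_integral_of_int: "p_integral p (of_int n)"
  using p_integral_frac[of 1 n] prime_gt_1_nat[OF prime_p] by simp

lemma p_integral_add:
  assumes "p_integral p a" "p_integral p b"
  shows "p_integral p (a + b)"
proof -
  obtain n d k e where *: "a = of_int n / of_int d" "\<not> int p dvd d" "b = of_int k / of_int e" "\<not> int p dvd e"
    using assms p_integral_iff[OF prime_p] by metis
  then have "d \<noteq> 0" "e \<noteq> 0"
    by auto
  then have "a + b = of_int (n * e + k * d) / of_int (d * e)"
    using * by (simp add: field_simps)
  moreover have "\<not> int p dvd d * e"
    using * prime_p by (simp add: prime_dvd_mult_iff)
  ultimately show ?thesis
    using p_integral_frac by metis
qed

lemma p_integral_mult:
  assumes "p_integral p a" "p_integral p b"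
  shows "p_integral p (a * b)"
proof -
  obtain n d k e where *: "a = of_int n / of_int d" "\<not> int p dvd d" "b = of_int k / of_int e" "\<not> int p dvd e"
    using assms p_integral_iff[OF prime_p] by metis
  have "a * b = of_int (n * k) / of_int (d * e)"
    using * by simp
  moreover have "\<not> int p dvd d * e"
    using * prime_p by (simp add: prime_dvd_mult_iff)
  ultimately show ?thesis
    using p_integral_frac by metis
qed

lemma p_integral_uminus: "p_integral p a \<Longrightarrow> p_integral p (- a)"
  using p_integral_mult[OF p_integral_of_int[of "-1"]] by simp

lemma p_integral_sum: "(\<And>i. i \<in> I \<Longrightarrow> p_integral p (f i)) \<Longrightarrow> p_integral p (\<Sum>i\<in>I. f i)"
  by (induction I rule: infinite_finite_induct) (use p_integral_of_int[of 0] p_integral_add in auto)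

lemma rat_cong_refl: "p_integral p a \<Longrightarrow> [a \<equiv> a] (rmod p)"
  using p_integral_of_int[of 0] by (simp add: rat_cong_def)

lemma rat_cong_sym: "[a \<equiv> b] (rmod p) \<Longrightarrow> [b \<equiv> a] (rmod p)"
  using p_integral_uminus[of "(a - b) / of_nat p"] by (simp add: rat_cong_def minus_divide_left)

lemma rat_cong_trans: "[a \<equiv> b] (rmod p) \<Longrightarrow> [b \<equiv> c] (rmod p) \<Longrightarrow> [a \<equiv> c] (rmod p)"
  using p_integral_add[of "(a - b) / of_nat p" "(b - c) / of_nat p"]
  by (simp add: rat_cong_def add_divide_distrib[symmetric])

lemma rat_cong_add: "[a \<equiv> b] (rmod p) \<Longrightarrow> [c \<equiv> d] (rmod p) \<Longrightarrow> [a + c \<equiv> b + d] (rmod p)"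
  using p_integral_add[of "(a - b) / of_nat p" "(c - d) / of_nat p"]
  by (simp add: rat_cong_def p_integral_add add_divide_distrib[symmetric] algebra_simps)

lemma rat_cong_sum:
  "(\<And>i. i \<in> I \<Longrightarrow> [f i \<equiv> g i] (rmod p)) \<Longrightarrow> [(\<Sum>i\<in>I. f i) \<equiv> (\<Sum>i\<in>I. g i)] (rmod p)"
  by (induction I rule: infinite_finite_induct)
    (use rat_cong_refl[OF p_integral_of_int[of 0]] rat_cong_add in auto)

lemma rat_cong_frac:
  assumes "[x = y] (mod int p)" "\<not> int p dvd d"
  shows "[of_int x / of_int d \<equiv> of_int y / of_int d] (rmod p)"
proof -
  obtain k where "x - y = int p * k"
    using assms(1) by (auto simp: cong_iff_dvd_diff)
  then have "(of_int x :: rat) - of_int y = of_nat p * of_int k"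
    by (metis of_int_diff of_int_mult of_int_of_nat_eq)
  then have "((of_int x / of_int d :: rat) - of_int y / of_int d) / of_nat p = of_int k / of_int d"
    using prime_gt_0_nat[OF prime_p] by (simp add: diff_divide_distrib[symmetric])
  then show ?thesis
    using p_integral_frac[OF assms(2)] by (simp add: rat_cong_def)
qed

end

section \<open>Catalan numbers and the exact telescoping of the two sums\<close>

text \<open>Shows that Catalan numbers are integers. This matters at \<open>k = p - 1\<close>, where
  the denominator \<open>k + 1\<close> equals \<open>p\<close>.\<close>

lemma catalan_eq_diff: "catalan k = of_nat ((2 * k) choose k) - of_nat ((2 * k) choose Suc k)"
proof -
  have "Suc k * ((2 * k) choose Suc k) = k * ((2 * k) choose k)"
    using times_choose_Suc[of k "2 * k"] by simp
  then have "(of_nat (Suc k) :: rat) * of_nat ((2 * k) choose Suc k) = of_nat k * of_nat ((2 * k) choose k)"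
    by (simp only: of_nat_mult[symmetric])
  then show ?thesis
    unfolding catalan_def by (simp add: field_simps)
qed

text \<open>Induction on the exact recurrence for \<open>k * a k\<close>. At \<open>n = p\<close>
  the right-hand side carries an explicit factor \<open>p\<close>.\<close>

lemma weighted_sum_telescope:
  fixes n :: nat
  defines "a \<equiv> \<lambda>k. of_nat ((4 * k) choose (2 * k)) * of_nat ((2 * k) choose k) / 72 ^ k :: rat"
  shows "(\<Sum>k<n. of_nat k * a k) - 3 / 2 * (\<Sum>k<n. a k / of_nat (k + 1)) = - 9 * (of_nat n * a n)"
proof (induction n)
  case (Suc n)
  have c: "of_nat (Suc j) * of_nat ((2 * Suc j) choose Suc j)
      = 2 * (2 * of_nat j + 1) * (of_nat ((2 * j) choose j) :: rat)" for j
    using Suc_times_central_binomial[of j, THEN arg_cong[of _ _ "of_nat :: nat \<Rightarrow> rat"]]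
    by (simp only: of_nat_mult of_nat_add of_nat_numeral of_nat_1)
  let ?n = "of_nat n :: rat"
  define A B :: rat where "A = of_nat ((4 * n) choose (2 * n))" and "B = of_nat ((2 * n) choose n)"
  \<comment> \<open>\<open>A1\<close> is the central coefficient of row \<open>4 * n + 2\<close>,
    halfway between those of rows \<open>4 * n\<close> and \<open>4 * n + 4\<close>.\<close>
  define A1 A2 B1 :: rat where "A1 = of_nat ((2 * Suc (2 * n)) choose Suc (2 * n))"
    and "A2 = of_nat ((4 * Suc n) choose (2 * Suc n))" and "B1 = of_nat ((2 * Suc n) choose Suc n)"
  have n1: "?n + 1 \<noteq> 0" "2 * ?n + 1 \<noteq> 0"
    using of_nat_0_le_iff[of n, where 'a = rat] by linarith+
  have "(2 * ?n + 1) * A1 = 2 * (4 * ?n + 1) * A"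
    using c[of "2 * n"] unfolding A1_def A_def by (simp del: binomial_Suc_Suc add: algebra_simps)
  then have A1: "A1 = 2 * (4 * ?n + 1) * A / (2 * ?n + 1)"
    using n1 by (simp add: field_simps)
  have idx: "4 * Suc n = 2 * Suc (Suc (2 * n))" "2 * Suc n = Suc (Suc (2 * n))"
    by simp_all
  have "(2 * ?n + 2) * A2 = 2 * (4 * ?n + 3) * A1"
    using c[of "Suc (2 * n)"] unfolding A2_def A1_def idx by (simp del: binomial_Suc_Suc add: algebra_simps)
  then have A2: "A2 = 2 * (4 * ?n + 3) * A1 / (2 * (?n + 1))"
    using n1 by (simp add: field_simps)
  have "(?n + 1) * B1 = 2 * (2 * ?n + 1) * B"
    using c[of n] unfolding B1_def B_def by (simp del: binomial_Suc_Suc add: algebra_simps)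
  then have B1: "B1 = 2 * (2 * ?n + 1) * B / (?n + 1)"
    using n1 by (simp add: field_simps)
  have "of_nat (Suc n) * a (Suc n) = (?n + 1) * (A2 * B1 / (72 * 72 ^ n))"
    unfolding a_def A2_def B1_def by (simp del: binomial_Suc_Suc add: add.commute)
  also have "\<dots> = (4 * ?n + 1) * (4 * ?n + 3) * A * B / (18 * 72 ^ n * (?n + 1))"
    unfolding A2 A1 B1 using n1 by (simp add: divide_simps) (simp add: algebra_simps)
  also have "\<dots> = (4 * ?n + 1) * (4 * ?n + 3) / (18 * (?n + 1)) * a n"
    by (simp add: a_def A_def B_def algebra_simps)
  finally have step: "of_nat (Suc n) * a (Suc n) = (4 * ?n + 1) * (4 * ?n + 3) / (18 * (?n + 1)) * a n" .
  \<comment> \<open>From \<open>(4 n + 1) (4 n + 3) = 16 n (n + 1) + 3\<close>, the factor is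
    \<open>- 8 n - 3/2 / (n + 1)\<close>.\<close>
  have "- 9 * ((4 * ?n + 1) * (4 * ?n + 3) / (18 * (?n + 1)) * a n)
      = - 9 * (?n * a n) + (?n * a n - 3 / 2 * (a n / (?n + 1)))"
    using n1 by (simp add: field_simps)
  then show ?case
    unfolding step using Suc.IH by (simp add: algebra_simps)
qed simp

section \<open>From the rational sum to the integer polynomial sum\<close>

context odd_prime
begin

lemma not_dvd_72_power:
  assumes "p > 3"
  shows "\<not> int p dvd 72 ^ k"
proof -
  have "\<not> int p dvd 2" "\<not> int p dvd 3"
    using assms not_dvd_small by auto
  moreover have "(72::int) = 2 * (2 * (2 * (3 * 3)))"
    by simp
  ultimately have "\<not> int p dvd 72"
    using prime_int_p by (simp only: prime_dvd_mult_iff) blast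
  then show ?thesis
    using prime_int_p prime_dvd_power by blast
qed

text \<open>Since \<open>16 / 72 = 2 / 9\<close>, the common denominator \<open>3 ^ m\<close> turns
  every term into one of the integer sum. Modulo \<open>p\<close>, \<open>3 ^ m\<close> is
  \<open>chi 3\<close>, which is its own inverse.\<close>

lemma weighted_sum_rat_cong:
  assumes "p > 3"
  shows "[(\<Sum>k<p. of_nat k * of_nat ((4 * k) choose (2 * k)) * of_nat ((2 * k) choose k) / 72 ^ k)
      \<equiv> of_int (chi 3 * poly_sum)] (rmod p)"
proof -
  have n3: "\<not> int p dvd 3"
    using assms not_dvd_small by auto
  have n72: "\<not> int p dvd 72 ^ k" for k
    using assms by (rule not_dvd_72_power)
  have n3m: "\<not> int p dvd 3 ^ m"
    using n3 prime_int_p prime_dvd_power by blast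
  let ?w = "\<lambda>k. int k * int (m choose (2 * k)) * int ((2 * k) choose k) * 2 ^ k * 3 ^ (m - 2 * k)"
  have "[of_nat k * of_nat ((4 * k) choose (2 * k)) * of_nat ((2 * k) choose k) / 72 ^ k
      \<equiv> of_int (?w k) / of_int (3 ^ m)] (rmod p)" if "k \<in> {..<p}" for k
  proof -
    have "[int k * (int ((4 * k) choose (2 * k)) * int ((2 * k) choose k))
        = int k * (16 ^ k * int (m choose (2 * k)) * int ((2 * k) choose k))] (mod int p)"
      using that by (intro cong_mult cong_refl binomial_product_cong) simp
    from rat_cong_frac[OF prime_p this n72[of k]]
    have "[of_nat k * of_nat ((4 * k) choose (2 * k)) * of_nat ((2 * k) choose k) / 72 ^ k
        \<equiv> of_nat k * (16 ^ k * of_nat (m choose (2 * k)) * of_nat ((2 * k) choose k)) / 72 ^ k] (rmod p)"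
      by (simp add: mult.assoc)
    also have "of_nat k * (16 ^ k * of_nat (m choose (2 * k)) * of_nat ((2 * k) choose k)) / 72 ^ k
        = (of_int (?w k) / of_int (3 ^ m) :: rat)"
    \<comment> \<open>Where \<open>m - 2 * k\<close> truncates, the factor
      \<open>m choose (2 * k)\<close> is 0.\<close>
    proof (cases "2 * k \<le> m")
      case True
      then have "(3::rat) ^ m = 3 ^ (m - 2 * k) * 9 ^ k"
        using power_add[of "3::rat" "m - 2 * k" "2 * k"] by (simp add: power_mult)
      moreover have "(72::rat) ^ k = 8 ^ k * 9 ^ k" "(16::rat) ^ k = 8 ^ k * 2 ^ k"
        by (simp_all flip: power_mult_distrib)
      ultimately show ?thesis
        by (simp add: field_simps)
    qed (simp add: binomial_eq_0)
    finally show ?thesis .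
  qed
  from rat_cong_sum[OF prime_p this]
  have "[(\<Sum>k<p. of_nat k * of_nat ((4 * k) choose (2 * k)) * of_nat ((2 * k) choose k) / 72 ^ k)
      \<equiv> of_int (\<Sum>k<p. ?w k) / of_int (3 ^ m)] (rmod p)"
    by (simp only: of_int_sum sum_divide_distrib)
  moreover have "[(\<Sum>k<p. ?w k) = 3 ^ m * (chi 3 * poly_sum)] (mod int p)"
  proof -
    have "[chi 3 * chi 3 * poly_sum = 3 ^ m * chi 3 * poly_sum] (mod int p)"
      by (intro cong_mult cong_refl euler)
    then show ?thesis
      using cong_trans[OF weighted_sum_cong] chi_square[OF n3] by (simp add: mult.assoc)
  qed
  from rat_cong_frac[OF prime_p this n3m]
  have "[of_int (\<Sum>k<p. ?w k) / of_int (3 ^ m) \<equiv> of_int (chi 3 * poly_sum)] (rmod p)"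
    by simp
  ultimately show ?thesis
    by (rule rat_cong_trans[OF prime_p])
qed

end

section \<open>Assembly of the three congruences\<close>

theorem theorem1p6:
  fixes p :: nat
  assumes "prime p" and "p > 3"
  shows
    "[(\<Sum>k=0..p-1. of_nat k * of_nat ((4 * k) choose (2 * k)) * of_nat ((2 * k) choose k) / 72 ^ k)
      \<equiv> 3 / 2 * (\<Sum>k=0..p-1. of_nat ((4 * k) choose (2 * k)) * catalan k / 72 ^ k)] (rmod p)
     \<and> (\<forall>x y :: int. int p = x\<^sup>2 + y\<^sup>2 \<and> 4 dvd x - 1 \<and> 2 dvd y \<longrightarrow>
          [3 / 2 * (\<Sum>k=0..p-1. of_nat ((4 * k) choose (2 * k)) * catalan k / 72 ^ k)
            \<equiv> of_int (Legendre 6 (int p)) * of_int x] (rmod p))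
     \<and> ([p = 3] (mod 4) \<longrightarrow>
          [3 / 2 * (\<Sum>k=0..p-1. of_nat ((4 * k) choose (2 * k)) * catalan k / 72 ^ k)
            \<equiv> 3 / 4 * of_int (Legendre 6 (int p))
                * of_nat (((p + 1) div 2) choose ((p + 1) div 4))] (rmod p))"
proof -
  define m where "m = (p - 1) div 2"
  have "odd p"
    using assms prime_odd_nat by simp
  then interpret odd_prime p m
    using assms by unfold_locales (auto simp: m_def)
  have range: "{0..p-1} = {..<p}"
    using assms by auto
  define a where "a k = (of_nat ((4 * k) choose (2 * k)) * of_nat ((2 * k) choose k) / 72 ^ k :: rat)" for k
  define S1 where "S1 = (\<Sum>k<p. of_nat k * of_nat ((4 * k) choose (2 * k)) * of_nat ((2 * k) choose k) / 72 ^ k :: rat)"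
  define S2 where "S2 = (\<Sum>k<p. of_nat ((4 * k) choose (2 * k)) * catalan k / 72 ^ k :: rat)"
  have n2: "\<not> int p dvd 2"
    using assms not_dvd_small by auto
  have n4: "\<not> int p dvd 4"
    using n2 prime_int_p prime_dvd_mult_iff[of "int p" 2 2] by simp
  have n72: "\<not> int p dvd 72 ^ k" for k
    using assms(2) by (rule not_dvd_72_power)
  have S1: "S1 = (\<Sum>k<p. of_nat k * a k)" and S2: "S2 = (\<Sum>k<p. a k / of_nat (k + 1))"
    unfolding S1_def S2_def by (simp_all add: a_def catalan_def mult_ac)
  have S1_val: "[S1 \<equiv> of_int (chi 3 * poly_sum)] (rmod p)"
    unfolding S1_def using weighted_sum_rat_cong assms(2) .
  have first: "[S1 \<equiv> 3 / 2 * S2] (rmod p)"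
    unfolding rat_cong_def
  proof (intro conjI)
    show "p_integral p S1"
      using S1_val by (simp add: rat_cong_def)
    have "p_integral p (of_nat ((4 * k) choose (2 * k)) * catalan k / 72 ^ k)" for k
      using p_integral_frac[OF assms(1) n72[of k],
          of "int ((4 * k) choose (2 * k)) * (int ((2 * k) choose k) - int ((2 * k) choose Suc k))"]
      by (simp add: catalan_eq_diff)
    then have "p_integral p S2"
      unfolding S2_def by (intro p_integral_sum[OF assms(1)])
    then show "p_integral p (3 / 2 * S2)"
      using p_integral_mult[OF assms(1)] p_integral_frac[OF assms(1) n2, of 3] by fastforce
    \<comment> \<open>Telescoping up to \<open>n = p\<close> leaves a multiple of \<open>p\<close>,
      which absorbs the division by \<open>p\<close>.\<close>
    have "S1 - 3 / 2 * S2 = - 9 * (of_nat p * a p)"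
      unfolding S1 S2 a_def by (rule weighted_sum_telescope)
    then have "(S1 - 3 / 2 * S2) / of_nat p = of_int (-9 * (int ((4 * p) choose (2 * p)) * int ((2 * p) choose p))) / of_int (72 ^ p)"
      using assms by (simp add: a_def)
    then show "p_integral p ((S1 - 3 / 2 * S2) / of_nat p)"
      using p_integral_frac[OF assms(1) n72[of p]] by metis
  qed
  have S2_val: "[3 / 2 * S2 \<equiv> of_int (chi 3 * poly_sum)] (rmod p)"
    using rat_cong_trans[OF assms(1) rat_cong_sym[OF assms(1) first] S1_val] .
  have chi6: "chi 6 = chi 3 * chi 2"
    using chi_mult[of 3 2] by simp
  have second: "[3 / 2 * S2 \<equiv> of_int (chi 6) * of_int x] (rmod p)"
    if xy: "int p = x\<^sup>2 + y\<^sup>2" "4 dvd x - 1" "2 dvd y" for x y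
  proof -
    have "4 dvd int p - 1"
    proof -
      obtain u v where "x = 4 * u + 1" "y = 2 * v"
        using xy(2,3) by (metis diff_eq_eq dvdE)
      then have "int p - 1 = 4 * (4 * u\<^sup>2 + 2 * u + v\<^sup>2)"
        using xy(1) by (simp add: power2_eq_square algebra_simps)
      then show ?thesis
        by simp
    qed
    then have "even m"
      using p_eq by simp presburger
    then obtain n where n: "m = 2 * n"
      by blast
    have "[2 * poly_sum = chi 2 * (2 * x)] (mod int p)"
      using cong_trans[OF poly_sum_even[OF n] cong_mult[OF cong_refl gauss_central_binomial[OF n xy]]] .
    then have "[2 * poly_sum = 2 * (chi 2 * x)] (mod int p)"
      by (simp add: mult_ac)
    then have "[poly_sum = chi 2 * x] (mod int p)"
      using cong_mult_lcancel coprime_pI[OF n2] by blast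
    then have "[chi 3 * poly_sum = chi 6 * x] (mod int p)"
      unfolding chi6 mult.assoc by (intro cong_mult cong_refl)
    from rat_cong_frac[OF assms(1) this, of 1]
    have "[of_int (chi 3 * poly_sum) \<equiv> of_int (chi 6) * of_int x] (rmod p)"
      using assms(2) by simp
    then show ?thesis
      using rat_cong_trans[OF assms(1) S2_val] by blast
  qed
  have third: "[3 / 2 * S2 \<equiv> 3 / 4 * of_int (chi 6) * of_nat (((p + 1) div 2) choose ((p + 1) div 4))] (rmod p)"
    if "[p = 3] (mod 4)"
  proof -
    define h where "h = (p + 1) div 4"
    have "p mod 4 = 3"
      using that by (simp add: cong_def)
    then have h: "m + 1 = 2 * h" "(p + 1) div 2 = 2 * h"
      unfolding h_def m_def by presburger+
    \<comment> \<open>The factor 4 is kept so that dividing by this unit modulo \<open>p\<close>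
      produces \<open>3 / 4\<close>.\<close>
    have "[chi 3 * (4 * poly_sum) = chi 3 * (3 * chi 2 * int ((2 * h) choose h))] (mod int p)"
      by (rule cong_mult[OF cong_refl poly_sum_odd[OF h(1)]])
    from rat_cong_frac[OF assms(1) this n4]
    have "[of_int (chi 3 * poly_sum) \<equiv> 3 / 4 * of_int (chi 6) * of_nat ((2 * h) choose h)] (rmod p)"
      by (simp add: chi6 mult_ac)
    then show ?thesis
      unfolding h(2) h_def[symmetric] using rat_cong_trans[OF assms(1) S2_val] by blast
  qed
  show ?thesis
    unfolding range S1_def[symmetric] S2_def[symmetric] using first second third by blast
qed

end
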